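(* If $x\in2^\omega$ is $\Delta^1_1$-dominated and $\Delta^1_1$-semi-traceable, then $x$ is low for $\Delta^1_1$-Kurtz tests: every $\Delta^1_1(x)$ open set $U\subseteq2^\omega$ with $\mu(U)=1$ has a $\Delta^1_1$ open subset $V\subseteq U$ with $\mu(V)=1$.
   Context: $\mu$ is the uniform measure on $2^\omega$. An open set $U$ is $\Delta^1_1(x)$ (resp. $\Delta^1_1$) if $U=\bigcup_{\sigma\in W}[\sigma]$ for a set $W\subseteq2^{<\omega}$ which is $\Delta^1_1(x)$ (resp. $\Delta^1_1$), where $[\sigma]$ is the set of reals extending $\sigma$. $x$ is $\Delta^1_1$-dominated if every $f:\omega\to\omega$ with $f\le_h x$ is dominated everywhere by a hyperarithmetic function. $x$ is $\Delta^1_1$-semi-traceable if for each $f\le_h x$ there is a hyperarithmetic $g$ with $f(n)=g(n)$ for infinitely many $n$. *)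

theory Defs
  imports "HOL-Probability.Probability" "HOL-Library.Nat_Bijection"
begin

text \<open>
  Arithmetical formulas over the standard model, in a language expanded by a unary predicate
  symbol (\<open>InX\<close>, for a real \<open>x\<close>) and a unary function symbol (\<open>App\<close>, for a function \<open>f\<close>).
  Number variables are de Bruijn indices: quantifiers range over numbers only.
\<close>

datatype aterm =
    AVar nat
  | AZero
  | ASuc aterm
  | AAdd aterm aterm
  | AMul aterm aterm
  | App aterm

datatype aform =
    AEq aterm aterm
  | InX aterm
  | ANeg aform
  | AAnd aform aform
  | AEx aform

primrec aval :: "(nat \<Rightarrow> nat) \<Rightarrow> (nat \<Rightarrow> nat) \<Rightarrow> aterm \<Rightarrow> nat" where
  "aval f e (AVar i) = e i"
| "aval f e AZero = 0"
| "aval f e (ASuc t) = Suc (aval f e t)"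
| "aval f e (AAdd s t) = aval f e s + aval f e t"
| "aval f e (AMul s t) = aval f e s * aval f e t"
| "aval f e (App t) = f (aval f e t)"

primrec asat :: "(nat \<Rightarrow> bool) \<Rightarrow> (nat \<Rightarrow> nat) \<Rightarrow> (nat \<Rightarrow> nat) \<Rightarrow> aform \<Rightarrow> bool" where
  "asat x f e (AEq s t) \<longleftrightarrow> aval f e s = aval f e t"
| "asat x f e (InX t) \<longleftrightarrow> x (aval f e t)"
| "asat x f e (ANeg p) \<longleftrightarrow> \<not> asat x f e p"
| "asat x f e (AAnd p q) \<longleftrightarrow> asat x f e p \<and> asat x f e q"
| "asat x f e (AEx p) \<longleftrightarrow> (\<exists>n. asat x f (case_nat n e) p)"

text \<open>
  A set of numbers is \<open>\<Sigma>\<^sup>1\<^sub>1(x)\<close> if it is defined by \<open>\<exists>f \<in> \<omega>\<^sup>\<omega>. p(n, f, x)\<close> with \<open>p\<close> arithmetical.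
  The argument \<open>n\<close> is variable 0; stray free variables of \<open>p\<close> read 0, so they act as the
  constant 0 and do not smuggle in further parameters.
\<close>

definition Sigma11_in :: "(nat \<Rightarrow> bool) \<Rightarrow> nat set \<Rightarrow> bool" where
  "Sigma11_in x A \<longleftrightarrow> (\<exists>p. A = {n. \<exists>f. asat x f (case_nat n (\<lambda>_. 0)) p})"

definition Delta11_in :: "(nat \<Rightarrow> bool) \<Rightarrow> nat set \<Rightarrow> bool" where
  "Delta11_in x A \<longleftrightarrow> Sigma11_in x A \<and> Sigma11_in x (- A)"

text \<open>The lightface notions are obtained by taking the empty set as the parameter.\<close>

definition empty_real :: "nat \<Rightarrow> bool" where
  "empty_real = (\<lambda>_. False)"

text \<open>
  For functions, \<open>f \<le>\<^sub>h x\<close> means that \<open>f\<close>, viewed as its graph, is \<open>\<Delta>\<^sup>1\<^sub>1(x)\<close>.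
  Pairs and strings are coded by numbers through recursive injections.
\<close>

definition hyp_in :: "(nat \<Rightarrow> nat) \<Rightarrow> (nat \<Rightarrow> bool) \<Rightarrow> bool" (infix "\<le>\<^sub>h" 50) where
  "f \<le>\<^sub>h x \<longleftrightarrow> Delta11_in x (range (\<lambda>n. prod_encode (n, f n)))"

definition hyperarithmetic :: "(nat \<Rightarrow> nat) \<Rightarrow> bool" where
  "hyperarithmetic f \<longleftrightarrow> f \<le>\<^sub>h empty_real"

definition string_code :: "bool list \<Rightarrow> nat" where
  "string_code \<sigma> = list_encode (map of_bool \<sigma>)"

definition cylinder :: "bool list \<Rightarrow> (nat \<Rightarrow> bool) set" where
  "cylinder \<sigma> = {y. \<forall>i < length \<sigma>. y i = \<sigma> ! i}"

definition Delta11_open_in :: "(nat \<Rightarrow> bool) \<Rightarrow> (nat \<Rightarrow> bool) set \<Rightarrow> bool" where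
  "Delta11_open_in x U \<longleftrightarrow>
     (\<exists>W. Delta11_in x (string_code ` W) \<and> U = (\<Union>\<sigma>\<in>W. cylinder \<sigma>))"

definition Delta11_open :: "(nat \<Rightarrow> bool) set \<Rightarrow> bool" where
  "Delta11_open U \<longleftrightarrow> Delta11_open_in empty_real U"

definition cantor_measure :: "(nat \<Rightarrow> bool) measure" where
  "cantor_measure = (\<Pi>\<^sub>M i\<in>UNIV. measure_pmf (bernoulli_pmf (1/2)))"

definition Delta11_dominated :: "(nat \<Rightarrow> bool) \<Rightarrow> bool" where
  "Delta11_dominated x \<longleftrightarrow>
     (\<forall>f. f \<le>\<^sub>h x \<longrightarrow> (\<exists>g. hyperarithmetic g \<and> (\<forall>n. f n \<le> g n)))"

definition Delta11_semi_traceable :: "(nat \<Rightarrow> bool) \<Rightarrow> bool" where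
  "Delta11_semi_traceable x \<longleftrightarrow>
     (\<forall>f. f \<le>\<^sub>h x \<longrightarrow> (\<exists>g. hyperarithmetic g \<and> infinite {n. f n = g n}))"

definition low_for_Delta11_Kurtz_tests :: "(nat \<Rightarrow> bool) \<Rightarrow> bool" where
  "low_for_Delta11_Kurtz_tests x \<longleftrightarrow>
     (\<forall>U. Delta11_open_in x U \<and> measure cantor_measure U = 1 \<longrightarrow>
        (\<exists>V. Delta11_open V \<and> V \<subseteq> U \<and> measure cantor_measure V = 1))"

end

theory Submission
  imports Defs "HOL-Library.Sublist"
begin

text \<open>
  Since \<open>U\<close> has measure one, a function \<open>f \<le>\<^sub>h x\<close> picks for each \<open>k\<close> a code of a clopen set
  \<open>D\<^bsub>f k\<^esub> \<subseteq> U\<close> of measure at least \<open>1 - 2\<^sup>-\<^sup>k\<close>. Semi-traceability yields a hyperarithmetic \<open>g\<close>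
  agreeing with \<open>f\<close> infinitely often, and domination a hyperarithmetic bound \<open>b n\<close> on the first
  agreement past \<open>n\<close>. So \<open>V = (\<Union>n. \<Inter>k\<in>{n..b n}. D\<^bsub>g k\<^esub>)\<close>, where values \<open>g k\<close> not coding a clopen set
  of measure at least \<open>1 - 2\<^sup>-\<^sup>k\<close> are skipped, is contained in \<open>U\<close>, and the \<open>n\<close>-th intersection has
  measure at least \<open>1 - 2 \<cdot> 2\<^sup>-\<^sup>n\<close>.
\<close>

section \<open>Closure properties of predicates on environments\<close>

definition Sigma11_pred :: "(nat \<Rightarrow> bool) \<Rightarrow> ((nat \<Rightarrow> nat) \<Rightarrow> bool) \<Rightarrow> bool" where
  "Sigma11_pred x P \<longleftrightarrow> (\<exists>p. \<forall>e. P e \<longleftrightarrow> (\<exists>f. asat x f e p))"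

lemma Sigma11_predI: "(\<And>e. P e \<longleftrightarrow> (\<exists>f. asat x f e p)) \<Longrightarrow> Sigma11_pred x P"
  unfolding Sigma11_pred_def by blast

primrec rename_term :: "(nat \<Rightarrow> nat) \<Rightarrow> aterm \<Rightarrow> aterm" where
  "rename_term r (AVar i) = AVar (r i)"
| "rename_term r AZero = AZero"
| "rename_term r (ASuc t) = ASuc (rename_term r t)"
| "rename_term r (AAdd s t) = AAdd (rename_term r s) (rename_term r t)"
| "rename_term r (AMul s t) = AMul (rename_term r s) (rename_term r t)"
| "rename_term r (App t) = App (rename_term r t)"

primrec rename :: "(nat \<Rightarrow> nat) \<Rightarrow> aform \<Rightarrow> aform" where
  "rename r (AEq s t) = AEq (rename_term r s) (rename_term r t)"
| "rename r (InX t) = InX (rename_term r t)"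
| "rename r (ANeg p) = ANeg (rename r p)"
| "rename r (AAnd p q) = AAnd (rename r p) (rename r q)"
| "rename r (AEx p) = AEx (rename (case_nat 0 (\<lambda>i. Suc (r i))) p)"

lemma aval_rename: "aval f e (rename_term r t) = aval f (\<lambda>i. e (r i)) t"
  by (induction t) auto

lemma asat_rename: "asat x f e (rename r p) \<longleftrightarrow> asat x f (\<lambda>i. e (r i)) p"
proof (induction p arbitrary: r e)
  case (AEx p)
  have "(\<lambda>i. case_nat n e (case_nat 0 (\<lambda>i. Suc (r i)) i)) = case_nat n (\<lambda>i. e (r i))" for n
    by (auto split: nat.split)
  then show ?case by (simp add: AEx.IH)
qed (auto simp: aval_rename)

lemma Sigma11_pred_rename:
  "Sigma11_pred x P \<Longrightarrow> Sigma11_pred x (\<lambda>e. P (\<lambda>i. e (r i)))"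
  unfolding Sigma11_pred_def using asat_rename by metis

primrec empty_param :: "aform \<Rightarrow> aform" where
  "empty_param (AEq s t) = AEq s t"
| "empty_param (InX t) = ANeg (AEq t t)"
| "empty_param (ANeg p) = ANeg (empty_param p)"
| "empty_param (AAnd p q) = AAnd (empty_param p) (empty_param q)"
| "empty_param (AEx p) = AEx (empty_param p)"

lemma asat_empty_param: "asat x f e (empty_param p) \<longleftrightarrow> asat empty_real f e p"
  by (induction p arbitrary: e) (auto simp: empty_real_def)

lemma Sigma11_pred_mono: "Sigma11_pred empty_real P \<Longrightarrow> Sigma11_pred x P"
  unfolding Sigma11_pred_def using asat_empty_param by metis

text \<open>A pairing that is a term of the language; \<^const>\<open>prod_encode\<close> is not.\<close>

definition sq_pair :: "nat \<Rightarrow> nat \<Rightarrow> nat" where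
  "sq_pair a b = (a + b) * (a + b) + a"

lemma sq_pair_inj: "sq_pair a b = sq_pair c d \<longleftrightarrow> a = c \<and> b = d"
proof
  assume eq: "sq_pair a b = sq_pair c d"
  have less: "sq_pair a b < sq_pair c d" if "a + b < c + d" for a b c d
  proof -
    have "Suc (a + b) * Suc (a + b) \<le> (c + d) * (c + d)"
      using that by (intro mult_le_mono) auto
    then show ?thesis unfolding sq_pair_def by simp
  qed
  have "a + b = c + d"
    using eq less[of a b c d] less[of c d a b] by linarith
  then show "a = c \<and> b = d" using eq unfolding sq_pair_def by auto
qed auto

definition sq_pair_term :: "aterm \<Rightarrow> aterm \<Rightarrow> aterm" where
  "sq_pair_term s t = AAdd (AMul (AAdd s t) (AAdd s t)) s"

lemma aval_sq_pair_term [simp]: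
  "aval f e (sq_pair_term s t) = sq_pair (aval f e s) (aval f e t)"
  by (simp add: sq_pair_term_def sq_pair_def)

primrec slice_term :: "aterm \<Rightarrow> aterm \<Rightarrow> aterm" where
  "slice_term c (AVar i) = AVar i"
| "slice_term c AZero = AZero"
| "slice_term c (ASuc t) = ASuc (slice_term c t)"
| "slice_term c (AAdd s t) = AAdd (slice_term c s) (slice_term c t)"
| "slice_term c (AMul s t) = AMul (slice_term c s) (slice_term c t)"
| "slice_term c (App t) = App (sq_pair_term c (slice_term c t))"

primrec slice :: "nat \<Rightarrow> aform \<Rightarrow> aform" where
  "slice j (AEq s t) = AEq (slice_term (ASuc (AVar j)) s) (slice_term (ASuc (AVar j)) t)"
| "slice j (InX t) = InX (slice_term (ASuc (AVar j)) t)"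
| "slice j (ANeg p) = ANeg (slice j p)"
| "slice j (AAnd p q) = AAnd (slice j p) (slice j q)"
| "slice j (AEx p) = AEx (slice (Suc j) p)"

lemma aval_slice:
  "aval h e (slice_term c t) = aval (\<lambda>i. h (sq_pair (aval h e c) i)) e t"
  by (induction t) auto

lemma asat_slice:
  "asat x h e (slice j p) \<longleftrightarrow> asat x (\<lambda>i. h (sq_pair (Suc (e j)) i)) e p"
  by (induction p arbitrary: j e) (auto simp: aval_slice)

text \<open>Conjunction, universal number quantifiers and primitive recursion are all instances of this
  closure property: slice \<open>0\<close> of the new witness holds \<open>g\<close>, and slice \<open>k + 1\<close> holds the witness of
  the inner predicate at \<open>k\<close>.\<close>

lemma Sigma11_pred_path:
  assumes "Sigma11_pred x (\<lambda>e. Q (e 0) (e (Suc 0)) (e (Suc (Suc 0))) (\<lambda>i. e (Suc (Suc (Suc i)))))"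
  shows "Sigma11_pred x (\<lambda>e. \<exists>g. \<forall>k. Q (g (Suc k)) (g k) k e)"
proof -
  let ?env = "\<lambda>v u k e. case_nat v (case_nat u (case_nat k e))"
  obtain q where q: "\<And>e. Q (e 0) (e (Suc 0)) (e (Suc (Suc 0))) (\<lambda>i. e (Suc (Suc (Suc i))))
      \<longleftrightarrow> (\<exists>f. asat x f e q)"
    using assms unfolding Sigma11_pred_def by blast
  have Q: "Q v u k e \<longleftrightarrow> (\<exists>f. asat x f (?env v u k e) q)" for v u k e
    using q[of "?env v u k e"] by simp
  let ?p = "ANeg (AEx (ANeg (AEx (AEx (AAnd
      (AAnd (AEq (AVar 0) (App (sq_pair_term AZero (ASuc (AVar 2)))))
        (AEq (AVar 1) (App (sq_pair_term AZero (AVar 2)))))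
      (slice 2 q))))))"
  have p: "asat x h e ?p \<longleftrightarrow> (\<forall>k. asat x (\<lambda>i. h (sq_pair (Suc k) i))
      (?env (h (sq_pair 0 (Suc k))) (h (sq_pair 0 k)) k e) q)" for h e
    by (simp add: asat_slice numeral_2_eq_2)
  show ?thesis
  proof (rule Sigma11_predI[where p = ?p])
    fix e
    show "(\<exists>g. \<forall>k. Q (g (Suc k)) (g k) k e) \<longleftrightarrow> (\<exists>h. asat x h e ?p)"
    proof
      assume "\<exists>g. \<forall>k. Q (g (Suc k)) (g k) k e"
      then obtain g where "\<forall>k. \<exists>f. asat x f (?env (g (Suc k)) (g k) k e) q"
        using Q by blast
      then obtain F where F: "\<And>k. asat x (F k) (?env (g (Suc k)) (g k) k e) q"
        by metis
      define h where "h z = (case inv (\<lambda>(a, b). sq_pair a b) z of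
        (a, b) \<Rightarrow> (case a of 0 \<Rightarrow> g b | Suc k \<Rightarrow> F k b))" for z
      have "inv (\<lambda>(a, b). sq_pair a b) (sq_pair a b) = (a, b)" for a b
        using inv_f_f[of "\<lambda>(a, b). sq_pair a b" "(a, b)"] by (auto simp: inj_def sq_pair_inj)
      then have "h (sq_pair 0 b) = g b" "h (sq_pair (Suc k) b) = F k b" for k b
        by (auto simp: h_def)
      then have "asat x h e ?p" unfolding p using F by simp
      then show "\<exists>h. asat x h e ?p" by blast
    next
      assume "\<exists>h. asat x h e ?p"
      then obtain h where "asat x h e ?p" by blast
      then have "\<forall>k. Q (h (sq_pair 0 (Suc k))) (h (sq_pair 0 k)) k e"
        unfolding p Q by blast
      then show "\<exists>g. \<forall>k. Q (g (Suc k)) (g k) k e"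
        by (intro exI[of _ "\<lambda>k. h (sq_pair 0 k)"])
    qed
  qed
qed

lemma Sigma11_pred_all:
  assumes "Sigma11_pred x (\<lambda>e. P (\<lambda>i. e (Suc i)) (e 0))"
  shows "Sigma11_pred x (\<lambda>e. \<forall>n. P e n)"
  using Sigma11_pred_path[of x "\<lambda>v u k e. P e k"] Sigma11_pred_rename[OF assms, of "\<lambda>i. i + 2"]
  by simp

lemma Sigma11_pred_ex:
  assumes "Sigma11_pred x (\<lambda>e. P (\<lambda>i. e (Suc i)) (e 0))"
  shows "Sigma11_pred x (\<lambda>e. \<exists>n. P e n)"
proof -
  obtain p where p: "\<And>e. P (\<lambda>i. e (Suc i)) (e 0) \<longleftrightarrow> (\<exists>f. asat x f e p)"
    using assms unfolding Sigma11_pred_def by blast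
  have "P e n \<longleftrightarrow> (\<exists>f. asat x f (case_nat n e) p)" for e n
    using p[of "case_nat n e"] by simp
  then show ?thesis by (intro Sigma11_predI[of _ _ "AEx p"]) auto
qed

lemma Sigma11_pred_disj:
  assumes "Sigma11_pred x P" "Sigma11_pred x Q"
  shows "Sigma11_pred x (\<lambda>e. P e \<or> Q e)"
proof -
  obtain p q where "\<And>e. P e \<longleftrightarrow> (\<exists>f. asat x f e p)" "\<And>e. Q e \<longleftrightarrow> (\<exists>f. asat x f e q)"
    using assms unfolding Sigma11_pred_def by blast
  then show ?thesis by (intro Sigma11_predI[of _ _ "ANeg (AAnd (ANeg p) (ANeg q))"]) auto
qed

lemma Sigma11_pred_conj:
  assumes "Sigma11_pred x P" "Sigma11_pred x Q"
  shows "Sigma11_pred x (\<lambda>e. P e \<and> Q e)"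
proof -
  obtain p q where p: "\<And>e. P e \<longleftrightarrow> (\<exists>f. asat x f e p)" and q: "\<And>e. Q e \<longleftrightarrow> (\<exists>f. asat x f e q)"
    using assms unfolding Sigma11_pred_def by blast
  have "Sigma11_pred x (\<lambda>e. if e 0 = 0 then P (\<lambda>i. e (Suc i)) else Q (\<lambda>i. e (Suc i)))"
    by (rule Sigma11_predI[of _ _ "ANeg (AAnd (ANeg (AAnd (AEq (AVar 0) AZero) (rename Suc p)))
      (ANeg (AAnd (ANeg (AEq (AVar 0) AZero)) (rename Suc q))))"]) (auto simp: p q asat_rename)
  then have "Sigma11_pred x (\<lambda>e. \<forall>n::nat. if n = 0 then P e else Q e)"
    by (rule Sigma11_pred_all)
  moreover have "(\<lambda>e. \<forall>n::nat. if n = 0 then P e else Q e) = (\<lambda>e. P e \<and> Q e)"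
    by (auto simp: fun_eq_iff intro: zero_less_one)
  ultimately show ?thesis by simp
qed

definition Delta11_pred :: "(nat \<Rightarrow> bool) \<Rightarrow> ((nat \<Rightarrow> nat) \<Rightarrow> bool) \<Rightarrow> bool" where
  "Delta11_pred x P \<longleftrightarrow> Sigma11_pred x P \<and> Sigma11_pred x (\<lambda>e. \<not> P e)"

definition Delta11_fun :: "(nat \<Rightarrow> bool) \<Rightarrow> ((nat \<Rightarrow> nat) \<Rightarrow> nat) \<Rightarrow> bool" where
  "Delta11_fun x F \<longleftrightarrow> Sigma11_pred x (\<lambda>e. e 0 = F (\<lambda>i. e (Suc i)))"

lemma Delta11_pred_rename: "Delta11_pred x P \<Longrightarrow> Delta11_pred x (\<lambda>e. P (\<lambda>i. e (r i)))"
  unfolding Delta11_pred_def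
  using Sigma11_pred_rename[of x P r] Sigma11_pred_rename[of x "\<lambda>e. \<not> P e" r] by blast

lemma Delta11_fun_rename:
  assumes "Delta11_fun x F"
  shows "Delta11_fun x (\<lambda>e. F (\<lambda>i. e (r i)))"
  using Sigma11_pred_rename[OF assms[unfolded Delta11_fun_def], of "case_nat 0 (\<lambda>i. Suc (r i))"]
  by (simp add: Delta11_fun_def)

lemma Delta11_pred_not: "Delta11_pred x P \<Longrightarrow> Delta11_pred x (\<lambda>e. \<not> P e)"
  unfolding Delta11_pred_def by simp

lemma Delta11_pred_conj:
  "Delta11_pred x P \<Longrightarrow> Delta11_pred x Q \<Longrightarrow> Delta11_pred x (\<lambda>e. P e \<and> Q e)"
  unfolding Delta11_pred_def de_Morgan_conj de_Morgan_disj
  by (intro conjI Sigma11_pred_conj Sigma11_pred_disj; elim conjE; assumption)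

lemma Delta11_pred_disj:
  "Delta11_pred x P \<Longrightarrow> Delta11_pred x Q \<Longrightarrow> Delta11_pred x (\<lambda>e. P e \<or> Q e)"
  unfolding Delta11_pred_def de_Morgan_conj de_Morgan_disj
  by (intro conjI Sigma11_pred_conj Sigma11_pred_disj; elim conjE; assumption)

lemma Delta11_pred_imp:
  "Delta11_pred x P \<Longrightarrow> Delta11_pred x Q \<Longrightarrow> Delta11_pred x (\<lambda>e. P e \<longrightarrow> Q e)"
  unfolding imp_conv_disj by (intro Delta11_pred_disj Delta11_pred_not)

lemma Delta11_pred_ex:
  "Delta11_pred x (\<lambda>e. P (\<lambda>i. e (Suc i)) (e 0)) \<Longrightarrow> Delta11_pred x (\<lambda>e. \<exists>n. P e n)"
  unfolding Delta11_pred_def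
  using Sigma11_pred_ex[of x P] Sigma11_pred_all[of x "\<lambda>e n. \<not> P e n"] by simp

lemma Delta11_pred_all:
  "Delta11_pred x (\<lambda>e. P (\<lambda>i. e (Suc i)) (e 0)) \<Longrightarrow> Delta11_pred x (\<lambda>e. \<forall>n. P e n)"
  unfolding Delta11_pred_def
  using Sigma11_pred_all[of x P] Sigma11_pred_ex[of x "\<lambda>e n. \<not> P e n"] by simp

lemma Sigma11_pred_subst:
  assumes "Sigma11_pred x (\<lambda>e. P (e 0) (\<lambda>i. e (Suc i)))" "Delta11_fun x F"
  shows "Sigma11_pred x (\<lambda>e. P (F e) e)"
proof -
  have "Sigma11_pred x (\<lambda>e. \<exists>n. n = F e \<and> P n e)"
    using assms unfolding Delta11_fun_def by (intro Sigma11_pred_ex Sigma11_pred_conj)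
  then show ?thesis by simp
qed

lemma Delta11_pred_subst:
  assumes "Delta11_pred x (\<lambda>e. P (e 0) (\<lambda>i. e (Suc i)))" "Delta11_fun x F"
  shows "Delta11_pred x (\<lambda>e. P (F e) e)"
  using assms Sigma11_pred_subst[of x P F] Sigma11_pred_subst[of x "\<lambda>n e. \<not> P n e" F]
  unfolding Delta11_pred_def by simp

lemma Delta11_fun_subst:
  assumes "Delta11_fun x (\<lambda>e. H (e 0) (\<lambda>i. e (Suc i)))" "Delta11_fun x F"
  shows "Delta11_fun x (\<lambda>e. H (F e) e)"
proof -
  have "Sigma11_pred x (\<lambda>e. e (Suc 0) = H (e 0) (\<lambda>i. e (Suc (Suc i))))"
    using Sigma11_pred_rename[OF assms(1)[unfolded Delta11_fun_def],
      of "case_nat 1 (case_nat 0 (\<lambda>i. i + 2))"] by simp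
  then show ?thesis
    unfolding Delta11_fun_def
    using Sigma11_pred_subst[of x "\<lambda>n e. e 0 = H n (\<lambda>i. e (Suc i))" "\<lambda>e. F (\<lambda>i. e (Suc i))"]
      Delta11_fun_rename[OF assms(2), of Suc] by simp
qed

lemma Delta11_pred_comp:
  assumes "Delta11_pred x (\<lambda>e. P (e 0))" "Delta11_fun x F"
  shows "Delta11_pred x (\<lambda>e. P (F e))"
  using Delta11_pred_subst[of x "\<lambda>n e. P n"] assms by simp

lemma Delta11_pred_comp2:
  assumes "Delta11_pred x (\<lambda>e. P (e 0) (e (Suc 0)))" "Delta11_fun x F" "Delta11_fun x G"
  shows "Delta11_pred x (\<lambda>e. P (F e) (G e))"
proof -
  have "Delta11_pred x (\<lambda>e. P (F (\<lambda>i. e (Suc i))) (e 0))"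
    using Delta11_pred_subst[of x "\<lambda>n e. P n (e 0)" "\<lambda>e. F (\<lambda>i. e (Suc i))"]
      assms(1) Delta11_fun_rename[OF assms(2), of Suc] by simp
  then show ?thesis
    using Delta11_pred_subst[of x "\<lambda>n e. P (F e) n" G] assms(3) by simp
qed

lemma Delta11_fun_comp:
  assumes "Delta11_fun x (\<lambda>e. H (e 0))" "Delta11_fun x F"
  shows "Delta11_fun x (\<lambda>e. H (F e))"
  using Delta11_fun_subst[of x "\<lambda>n e. H n"] assms by simp

lemma Delta11_fun_comp2:
  assumes "Delta11_fun x (\<lambda>e. H (e 0) (e (Suc 0)))" "Delta11_fun x F" "Delta11_fun x G"
  shows "Delta11_fun x (\<lambda>e. H (F e) (G e))"
proof -
  have "Delta11_fun x (\<lambda>e. H (F (\<lambda>i. e (Suc i))) (e 0))"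
    using Delta11_fun_subst[of x "\<lambda>n e. H n (e 0)" "\<lambda>e. F (\<lambda>i. e (Suc i))"]
      assms(1) Delta11_fun_rename[OF assms(2), of Suc] by simp
  then show ?thesis
    using Delta11_fun_subst[of x "\<lambda>n e. H (F e) n" G] assms(3) by simp
qed

lemma Delta11_fun_var: "Delta11_fun x (\<lambda>e. e i)"
  unfolding Delta11_fun_def by (rule Sigma11_predI[of _ _ "AEq (AVar 0) (AVar (Suc i))"]) simp

lemma Delta11_fun_const: "Delta11_fun x (\<lambda>e. c)"
proof -
  have "aval f e ((ASuc ^^ c) AZero) = c" for f e
    by (induction c) auto
  then show ?thesis unfolding Delta11_fun_def
    by (intro Sigma11_predI[of _ _ "AEq (AVar 0) ((ASuc ^^ c) AZero)"]) simp
qed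

lemma Delta11_fun_Suc: "Delta11_fun x F \<Longrightarrow> Delta11_fun x (\<lambda>e. Suc (F e))"
  by (rule Delta11_fun_comp[where H = Suc])
    (auto simp: Delta11_fun_def intro: Sigma11_predI[of _ _ "AEq (AVar 0) (ASuc (AVar 1))"])

lemma Delta11_fun_add:
  "Delta11_fun x F \<Longrightarrow> Delta11_fun x G \<Longrightarrow> Delta11_fun x (\<lambda>e. F e + G e)"
  by (rule Delta11_fun_comp2[where H = "(+)"])
    (auto simp: Delta11_fun_def numeral_2_eq_2
      intro: Sigma11_predI[of _ _ "AEq (AVar 0) (AAdd (AVar 1) (AVar 2))"])

lemma Delta11_fun_mult:
  "Delta11_fun x F \<Longrightarrow> Delta11_fun x G \<Longrightarrow> Delta11_fun x (\<lambda>e. F e * G e)"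
  by (rule Delta11_fun_comp2[where H = "(*)"])
    (auto simp: Delta11_fun_def numeral_2_eq_2
      intro: Sigma11_predI[of _ _ "AEq (AVar 0) (AMul (AVar 1) (AVar 2))"])

lemma Delta11_pred_eq:
  "Delta11_fun x F \<Longrightarrow> Delta11_fun x G \<Longrightarrow> Delta11_pred x (\<lambda>e. F e = G e)"
  by (rule Delta11_pred_comp2[where P = "(=)"])
    (auto simp: Delta11_pred_def intro: Sigma11_predI[of _ _ "AEq (AVar 0) (AVar 1)"]
      Sigma11_predI[of _ _ "ANeg (AEq (AVar 0) (AVar 1))"])

lemma Delta11_pred_le:
  assumes "Delta11_fun x F" "Delta11_fun x G"
  shows "Delta11_pred x (\<lambda>e. F e \<le> G e)"
proof -
  have "Delta11_pred x (\<lambda>e. \<exists>n. e (Suc 0) = e 0 + n)"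
    by (intro Delta11_pred_ex Delta11_pred_eq Delta11_fun_add Delta11_fun_var)
  then have "Delta11_pred x (\<lambda>e. e 0 \<le> e (Suc 0))"
    by (simp add: le_iff_add)
  then show ?thesis using assms by (rule Delta11_pred_comp2)
qed

lemma Delta11_pred_less:
  assumes "Delta11_fun x F" "Delta11_fun x G"
  shows "Delta11_pred x (\<lambda>e. F e < G e)"
  using Delta11_pred_le[OF Delta11_fun_Suc[OF assms(1)] assms(2)] by (simp add: Suc_le_eq)

lemmas Delta11_intros =
  Delta11_fun_const Delta11_fun_var Delta11_fun_Suc Delta11_fun_add Delta11_fun_mult
  Delta11_pred_not Delta11_pred_conj Delta11_pred_disj Delta11_pred_imp Delta11_pred_ex
  Delta11_pred_all Delta11_pred_eq Delta11_pred_le Delta11_pred_less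

lemma Delta11_fun_graphI:
  "Delta11_pred x (\<lambda>e. e 0 = F (\<lambda>i. e (Suc i))) \<Longrightarrow> Delta11_fun x F"
  unfolding Delta11_fun_def Delta11_pred_def by blast

lemma Delta11_fun_if:
  assumes "Delta11_pred x P" "Delta11_fun x F" "Delta11_fun x G"
  shows "Delta11_fun x (\<lambda>e. if P e then F e else G e)"
proof (rule Delta11_fun_graphI)
  have "Delta11_pred x (\<lambda>e. (P (\<lambda>i. e (Suc i)) \<longrightarrow> e 0 = F (\<lambda>i. e (Suc i))) \<and>
      (\<not> P (\<lambda>i. e (Suc i)) \<longrightarrow> e 0 = G (\<lambda>i. e (Suc i))))"
    using Delta11_pred_rename[OF assms(1), of Suc] assms(2,3)[THEN Delta11_fun_rename, of Suc]
    by (intro Delta11_intros)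
  then show "Delta11_pred x (\<lambda>e. e 0 = (if P (\<lambda>i. e (Suc i)) then F (\<lambda>i. e (Suc i))
      else G (\<lambda>i. e (Suc i))))"
    by (simp add: if_split[of "\<lambda>y. _ = y"])
qed

lemma Delta11_fun_Least:
  assumes "Delta11_pred x (\<lambda>e. P (\<lambda>i. e (Suc i)) (e 0))" "\<And>e. \<exists>n. P e n"
  shows "Delta11_fun x (\<lambda>e. LEAST n. P e n)"
proof (rule Delta11_fun_graphI)
  have "Delta11_pred x (\<lambda>e. P (\<lambda>i. e (Suc i)) (e 0) \<and> (\<forall>n. n < e 0 \<longrightarrow> \<not> P (\<lambda>i. e (Suc i)) n))"
    using Delta11_pred_rename[OF assms(1), of "case_nat 0 (\<lambda>i. i + 2)"]
    by (intro Delta11_intros assms(1)) simp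
  moreover have "y = (LEAST n. P e n) \<longleftrightarrow> P e y \<and> (\<forall>n<y. \<not> P e n)" for e y
    by (metis LeastI_ex Least_equality assms(2) not_less not_less_Least)
  ultimately show "Delta11_pred x (\<lambda>e. e 0 = (LEAST n. P (\<lambda>i. e (Suc i)) n))"
    by simp
qed

lemma Delta11_fun_rec_nat:
  assumes A: "Delta11_fun x A" and N: "Delta11_fun x N"
    and B: "Delta11_fun x (\<lambda>e. B (e 0) (e (Suc 0)) (\<lambda>i. e (Suc (Suc i))))"
  shows "Delta11_fun x (\<lambda>e. rec_nat (A e) (\<lambda>k u. B k u e) (N e))"
proof -
  let ?Q = "\<lambda>v u k e'. v = B k u (\<lambda>i. e' (Suc i)) \<and> (k = 0 \<longrightarrow> u = A (\<lambda>i. e' (Suc i))) \<and>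
    (k = N (\<lambda>i. e' (Suc i)) \<longrightarrow> e' 0 = u)"
  have "Delta11_fun x (\<lambda>e. B (e 2) (e 1) (\<lambda>i. e (Suc (Suc (Suc (Suc i))))))"
    using Delta11_fun_rename[OF B, of "case_nat 2 (case_nat 1 (\<lambda>i. i + 4))"]
    by (simp add: numeral_eq_Suc)
  then have "Delta11_pred x (\<lambda>e. ?Q (e 0) (e 1) (e 2) (\<lambda>i. e (Suc (Suc (Suc i)))))"
    using A[THEN Delta11_fun_rename, of "\<lambda>i. Suc (Suc (Suc (Suc i)))"]
      N[THEN Delta11_fun_rename, of "\<lambda>i. Suc (Suc (Suc (Suc i)))"]
    by (intro Delta11_intros)
  then have sig: "Sigma11_pred x (\<lambda>e'. \<exists>g. \<forall>k. ?Q (g (Suc k)) (g k) k e')"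
    by (intro Sigma11_pred_path) (simp add: Delta11_pred_def numeral_2_eq_2)
  have "(\<exists>g. \<forall>k. g (Suc k) = B k (g k) e \<and> (k = 0 \<longrightarrow> g k = A e) \<and> (k = N e \<longrightarrow> y = g k)) \<longleftrightarrow>
      y = rec_nat (A e) (\<lambda>k u. B k u e) (N e)" (is "?L \<longleftrightarrow> ?R") for y e
  proof
    assume ?L
    then obtain g where g: "\<And>k. g (Suc k) = B k (g k) e" "g 0 = A e" "y = g (N e)" by blast
    have "g k = rec_nat (A e) (\<lambda>k u. B k u e) k" for k
      by (induction k) (auto simp: g)
    then show ?R using g(3) by simp
  next
    assume ?R
    then show ?L by (intro exI[of _ "rec_nat (A e) (\<lambda>k u. B k u e)"]) auto
  qed
  then show ?thesis using sig unfolding Delta11_fun_def by simp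
qed

lemma Delta11_fun_prod_encode:
  assumes "Delta11_fun x F" "Delta11_fun x G"
  shows "Delta11_fun x (\<lambda>e. prod_encode (F e, G e))"
proof (rule Delta11_fun_comp2[OF _ assms], rule Delta11_fun_graphI)
  have "Delta11_pred x (\<lambda>e. 2 * e 0 =
      (e (Suc 0) + e (Suc (Suc 0))) * Suc (e (Suc 0) + e (Suc (Suc 0))) + 2 * e (Suc 0))"
    by (intro Delta11_intros)
  moreover have "y = prod_encode (m, n) \<longleftrightarrow> 2 * y = (m + n) * Suc (m + n) + 2 * m" for y m n
  proof -
    have "2 * triangle (m + n) = (m + n) * Suc (m + n)"
      unfolding triangle_def by (rule dvd_mult_div_cancel) simp
    then show ?thesis by (auto simp: prod_encode_def simp del: mult_Suc_right)
  qed
  ultimately show "Delta11_pred x (\<lambda>e. e 0 = prod_encode (e (Suc 0), e (Suc (Suc 0))))"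
    by simp
qed

lemma Delta11_fun_fst_prod_decode:
  assumes "Delta11_fun x F"
  shows "Delta11_fun x (\<lambda>e. fst (prod_decode (F e)))"
proof (rule Delta11_fun_comp[OF _ assms], rule Delta11_fun_graphI)
  have "Delta11_pred x (\<lambda>e. \<exists>n. prod_encode (e 0, n) = e (Suc 0))"
    by (intro Delta11_intros Delta11_fun_prod_encode)
  moreover have "y = fst (prod_decode z) \<longleftrightarrow> (\<exists>n. prod_encode (y, n) = z)" for y z
    by (metis fst_conv prod.collapse prod_decode_inverse prod_encode_inverse)
  ultimately show "Delta11_pred x (\<lambda>e. e 0 = fst (prod_decode (e (Suc 0))))"
    by simp
qed

lemma Delta11_fun_snd_prod_decode:
  assumes "Delta11_fun x F"
  shows "Delta11_fun x (\<lambda>e. snd (prod_decode (F e)))"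
proof (rule Delta11_fun_comp[OF _ assms], rule Delta11_fun_graphI)
  have "Delta11_pred x (\<lambda>e. \<exists>n. prod_encode (n, e 0) = e (Suc 0))"
    by (intro Delta11_intros Delta11_fun_prod_encode)
  moreover have "y = snd (prod_decode z) \<longleftrightarrow> (\<exists>n. prod_encode (n, y) = z)" for y z
    by (metis snd_conv prod.collapse prod_decode_inverse prod_encode_inverse)
  ultimately show "Delta11_pred x (\<lambda>e. e 0 = snd (prod_decode (e (Suc 0))))"
    by simp
qed

lemma Sigma11_in_iff: "Sigma11_in x A \<longleftrightarrow> Sigma11_pred x (\<lambda>e. e 0 \<in> A)"
proof
  assume "Sigma11_in x A"
  then obtain p where p: "A = {n. \<exists>f. asat x f (case_nat n (\<lambda>_. 0)) p}"
    unfolding Sigma11_in_def by blast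
  have "Sigma11_pred x (\<lambda>e. \<exists>f. asat x f e p)"
    by (rule Sigma11_predI) simp
  then have "Sigma11_pred x (\<lambda>e. \<exists>f. asat x f (\<lambda>i. e (case_nat (Suc 0) (\<lambda>_. 0) i)) p)"
    by (rule Sigma11_pred_rename)
  moreover have "(\<lambda>i. e (case_nat (Suc 0) (\<lambda>_. 0) i)) = case_nat (e (Suc 0)) (\<lambda>_. e 0)" for e :: "nat \<Rightarrow> nat"
    by (auto split: nat.split)
  ultimately have "Sigma11_pred x (\<lambda>e. \<exists>f. asat x f (case_nat (e (Suc 0)) (\<lambda>_. e 0)) p)"
    by (simp only:)
  then show "Sigma11_pred x (\<lambda>e. e 0 \<in> A)"
    using Sigma11_pred_subst[of x "\<lambda>n e. \<exists>f. asat x f (case_nat (e 0) (\<lambda>_. n)) p" "\<lambda>e. 0"]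
      Delta11_fun_const[of x 0] by (simp add: p)
next
  assume "Sigma11_pred x (\<lambda>e. e 0 \<in> A)"
  then obtain p where p: "\<And>e. e 0 \<in> A \<longleftrightarrow> (\<exists>f. asat x f e p)"
    unfolding Sigma11_pred_def by blast
  have "A = {n. \<exists>f. asat x f (case_nat n (\<lambda>_. 0)) p}"
    using p[of "case_nat _ (\<lambda>_. 0)"] by auto
  then show "Sigma11_in x A" unfolding Sigma11_in_def by blast
qed

lemma Delta11_in_iff: "Delta11_in x A \<longleftrightarrow> Delta11_pred x (\<lambda>e. e 0 \<in> A)"
  unfolding Delta11_in_def Delta11_pred_def Sigma11_in_iff by simp

lemma hyp_in_iff: "f \<le>\<^sub>h x \<longleftrightarrow> Delta11_fun x (\<lambda>e. f (e 0))"
proof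
  assume "f \<le>\<^sub>h x"
  then have "Delta11_pred x (\<lambda>e. prod_encode (e (Suc 0), e 0) \<in> range (\<lambda>n. prod_encode (n, f n)))"
    unfolding hyp_in_def Delta11_in_iff
    by (rule Delta11_pred_comp) (intro Delta11_fun_prod_encode Delta11_intros)
  moreover have "prod_encode (n, y) \<in> range (\<lambda>n. prod_encode (n, f n)) \<longleftrightarrow> y = f n" for n y
    by auto
  ultimately show "Delta11_fun x (\<lambda>e. f (e 0))"
    by (intro Delta11_fun_graphI) simp
next
  assume "Delta11_fun x (\<lambda>e. f (e 0))"
  then have "Delta11_pred x (\<lambda>e. \<exists>n. e 0 = prod_encode (n, f n))"
    by (intro Delta11_intros Delta11_fun_prod_encode)
  then show "f \<le>\<^sub>h x" unfolding hyp_in_def Delta11_in_iff by (simp add: image_iff)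
qed

lemma hyperarithmetic_imp_hyp_in: "hyperarithmetic f \<Longrightarrow> f \<le>\<^sub>h x"
  unfolding hyperarithmetic_def hyp_in_iff Delta11_fun_def by (rule Sigma11_pred_mono)

section \<open>Codes of strings and of finite sets\<close>

lemma list_encode_tl: "list_encode (tl xs) = snd (prod_decode (list_encode xs - 1))"
proof (cases xs)
  case Nil
  have "prod_encode (0, 0) = 0" by (simp add: prod_encode_def)
  then have "prod_decode 0 = (0, 0)" by (metis prod_encode_inverse)
  then show ?thesis using Nil by simp
qed simp

lemma Delta11_fun_pred:
  assumes "Delta11_fun x F"
  shows "Delta11_fun x (\<lambda>e. F e - 1)"
proof (rule Delta11_fun_comp[OF _ assms], rule Delta11_fun_graphI)
  have "Delta11_pred x (\<lambda>e. e (Suc 0) = 0 \<and> e 0 = 0 \<or> e (Suc 0) = Suc (e 0))"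
    by (intro Delta11_intros)
  moreover have "n = 0 \<and> y = 0 \<or> n = Suc y \<longleftrightarrow> y = n - 1" for n y :: nat by auto
  ultimately show "Delta11_pred x (\<lambda>e. e 0 = e (Suc 0) - 1)" by simp
qed

lemma Delta11_fun_drop:
  assumes "Delta11_fun x F" "Delta11_fun x G"
  shows "Delta11_fun x (\<lambda>e. list_encode (drop (F e) (list_decode (G e))))"
proof -
  have "Delta11_fun x (\<lambda>e. rec_nat (e (Suc 0)) (\<lambda>k u. snd (prod_decode (u - 1))) (e 0))"
    by (intro Delta11_fun_rec_nat Delta11_intros Delta11_fun_snd_prod_decode Delta11_fun_pred)
  moreover have "rec_nat n (\<lambda>k u. snd (prod_decode (u - 1))) i = list_encode (drop i (list_decode n))"
    for n i
  proof (induction i)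
    case (Suc i)
    then show ?case by (simp add: list_encode_tl[symmetric] drop_Suc tl_drop del: One_nat_def)
  qed simp
  ultimately have "Delta11_fun x (\<lambda>e. list_encode (drop (e 0) (list_decode (e (Suc 0)))))"
    by simp
  then show ?thesis using assms by (rule Delta11_fun_comp2)
qed

lemma Delta11_fun_length:
  assumes "Delta11_fun x F"
  shows "Delta11_fun x (\<lambda>e. length (list_decode (F e)))"
proof (rule Delta11_fun_comp[OF _ assms])
  have iff: "list_encode (drop i xs) = 0 \<longleftrightarrow> length xs \<le> i" for i xs
    by (metis drop_eq_Nil list_encode.simps(1) list_encode_eq)
  have "Delta11_fun x (\<lambda>e. LEAST i. list_encode (drop i (list_decode (e 0))) = 0)"
    by (intro Delta11_fun_Least Delta11_intros Delta11_fun_drop) (auto simp: iff)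
  moreover have "(LEAST i. length xs \<le> i) = length xs" for xs :: "nat list"
    by (rule Least_equality) auto
  ultimately show "Delta11_fun x (\<lambda>e. length (list_decode (e 0)))"
    unfolding iff by simp
qed

text \<open>A total version of indexing: beyond the end of the list the value is junk.\<close>

definition code_nth :: "nat \<Rightarrow> nat \<Rightarrow> nat" where
  "code_nth s i = fst (prod_decode (list_encode (drop i (list_decode s)) - 1))"

lemma code_nth_eq: "i < length (list_decode s) \<Longrightarrow> code_nth s i = list_decode s ! i"
  unfolding code_nth_def by (simp add: Cons_nth_drop_Suc[symmetric])

lemma Delta11_fun_code_nth:
  "Delta11_fun x F \<Longrightarrow> Delta11_fun x G \<Longrightarrow> Delta11_fun x (\<lambda>e. code_nth (F e) (G e))"
  unfolding code_nth_def by (intro Delta11_fun_fst_prod_decode Delta11_fun_pred Delta11_fun_drop)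

lemma list_decode_string_code [simp]: "list_decode (string_code \<sigma>) = map of_bool \<sigma>"
  unfolding string_code_def by simp

lemma inj_string_code: "inj string_code"
proof (rule injI)
  fix \<sigma> \<tau> assume "string_code \<sigma> = string_code \<tau>"
  then have "map of_bool \<sigma> = (map of_bool \<tau> :: nat list)"
    unfolding string_code_def by (metis list_encode_inverse)
  moreover have "inj (of_bool :: bool \<Rightarrow> nat)" by (auto simp: inj_def)
  ultimately show "\<sigma> = \<tau>" by simp
qed

lemma range_string_code:
  "s \<in> range string_code \<longleftrightarrow> (\<forall>i. i < length (list_decode s) \<longrightarrow> code_nth s i < 2)"
proof
  assume "s \<in> range string_code"
  then obtain \<sigma> where "s = string_code \<sigma>" by blast
  then show "\<forall>i. i < length (list_decode s) \<longrightarrow> code_nth s i < 2"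
    by (auto simp: code_nth_eq)
next
  assume *: "\<forall>i. i < length (list_decode s) \<longrightarrow> code_nth s i < 2"
  have "list_decode s = map of_bool (map (\<lambda>n. n = 1) (list_decode s))"
    using * by (intro nth_equalityI) (auto simp: code_nth_eq less_2_cases_iff)
  then have "s = string_code (map (\<lambda>n. n = 1) (list_decode s))"
    unfolding string_code_def by (metis list_decode_inverse)
  then show "s \<in> range string_code" by blast
qed

lemma Delta11_pred_string:
  assumes "Delta11_fun x F"
  shows "Delta11_pred x (\<lambda>e. F e \<in> range string_code)"
  unfolding range_string_code using Delta11_fun_rename[OF assms, of Suc]
  by (intro Delta11_intros Delta11_fun_length Delta11_fun_code_nth)

lemma prefix_map_of_bool:
  "prefix (map of_bool \<sigma> :: nat list) (map of_bool \<tau>) \<longleftrightarrow> prefix \<sigma> \<tau>"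
proof
  assume "prefix (map of_bool \<sigma> :: nat list) (map of_bool \<tau>)"
  then obtain \<rho> where "prefix \<rho> \<tau>" "map of_bool \<sigma> = (map of_bool \<rho> :: nat list)"
    by (metis prefix_map_rightE)
  moreover have "inj (of_bool :: bool \<Rightarrow> nat)" by (auto simp: inj_def)
  ultimately show "prefix \<sigma> \<tau>" by simp
qed (rule map_mono_prefix)

lemma prefix_iff_nth:
  "prefix xs ys \<longleftrightarrow> length xs \<le> length ys \<and> (\<forall>i<length xs. xs ! i = ys ! i)"
proof
  assume "length xs \<le> length ys \<and> (\<forall>i<length xs. xs ! i = ys ! i)"
  then have "xs = take (length xs) ys" by (intro nth_equalityI) auto
  then show "prefix xs ys" by (metis take_is_prefix)
qed (auto simp: prefix_def nth_append)

lemma Delta11_pred_prefix: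
  assumes "Delta11_fun x F" "Delta11_fun x G"
  shows "Delta11_pred x (\<lambda>e. prefix (list_decode (F e)) (list_decode (G e)))"
proof (rule Delta11_pred_comp2[OF _ assms])
  have "Delta11_pred x (\<lambda>e. length (list_decode (e 0)) \<le> length (list_decode (e (Suc 0))) \<and>
      (\<forall>i. i < length (list_decode (e 0)) \<longrightarrow> code_nth (e 0) i = code_nth (e (Suc 0)) i))"
    by (intro Delta11_intros Delta11_fun_length Delta11_fun_code_nth)
  moreover have "length (list_decode s) \<le> length (list_decode t) \<and>
      (\<forall>i. i < length (list_decode s) \<longrightarrow> code_nth s i = code_nth t i) \<longleftrightarrow>
      prefix (list_decode s) (list_decode t)" for s t
    unfolding prefix_iff_nth by (auto simp: code_nth_eq)
  ultimately show "Delta11_pred x (\<lambda>e. prefix (list_decode (e 0)) (list_decode (e (Suc 0))))"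
    by simp
qed

lemma Delta11_fun_power2:
  assumes "Delta11_fun x F"
  shows "Delta11_fun x (\<lambda>e. 2 ^ F e)"
proof -
  have "Delta11_fun x (\<lambda>e. rec_nat 1 (\<lambda>k u. 2 * u) (F e))"
    by (intro Delta11_fun_rec_nat Delta11_intros assms)
  moreover have "rec_nat 1 (\<lambda>k u. 2 * u) n = (2 ^ n :: nat)" for n
    by (induction n) auto
  ultimately show ?thesis by simp
qed

lemma Delta11_pred_set_decode:
  assumes "Delta11_fun x F" "Delta11_fun x G"
  shows "Delta11_pred x (\<lambda>e. F e \<in> set_decode (G e))"
proof (rule Delta11_pred_comp2[OF _ assms])
  have "Delta11_pred x (\<lambda>e. \<exists>q r. e (Suc 0) = (2 * q + 1) * 2 ^ e 0 + r \<and> r < 2 ^ e 0)"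
    by (intro Delta11_intros Delta11_fun_power2)
  moreover have "(\<exists>q r. c = (2 * q + 1) * 2 ^ n + r \<and> r < 2 ^ n) \<longleftrightarrow> n \<in> set_decode c" for n c :: nat
  proof
    assume "\<exists>q r. c = (2 * q + 1) * 2 ^ n + r \<and> r < 2 ^ n"
    then obtain q r where "c = (2 * q + 1) * 2 ^ n + r" "r < 2 ^ n" by blast
    then have "c div 2 ^ n = 2 * q + 1"
      by (metis add.commute add_0 div_mult_self3 div_less mult.commute power_not_zero zero_neq_numeral)
    then show "n \<in> set_decode c" unfolding set_decode_def by simp
  next
    assume "n \<in> set_decode c"
    then obtain q where "c div 2 ^ n = 2 * q + 1"
      unfolding set_decode_def by (auto elim: oddE)
    then have "c = (2 * q + 1) * 2 ^ n + c mod 2 ^ n" by (metis div_mult_mod_eq)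
    moreover have "c mod 2 ^ n < 2 ^ n" by simp
    ultimately show "\<exists>q r. c = (2 * q + 1) * 2 ^ n + r \<and> r < 2 ^ n" by blast
  qed
  ultimately show "Delta11_pred x (\<lambda>e. e 0 \<in> set_decode (e (Suc 0)))"
    by simp
qed

lemma Delta11_fun_card_set_decode:
  assumes "Delta11_fun x F"
  shows "Delta11_fun x (\<lambda>e. card (set_decode (F e)))"
proof (rule Delta11_fun_comp[OF _ assms])
  have "Delta11_fun x (\<lambda>e. rec_nat 0 (\<lambda>k u. u + (if k \<in> set_decode (e 0) then 1 else 0)) (e 0))"
    by (intro Delta11_fun_rec_nat Delta11_intros Delta11_fun_if Delta11_pred_set_decode)
  moreover have "rec_nat 0 (\<lambda>k u. u + (if k \<in> A then 1 else 0)) n = card (A \<inter> {..<n})" for A n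
    by (induction n) (auto simp: lessThan_Suc)
  moreover have "set_decode c \<inter> {..<c} = set_decode c" for c
  proof -
    have "n < c" if "n \<in> set_decode c" for n
    proof (rule ccontr)
      assume "\<not> n < c"
      then have "c < 2 ^ n" by (meson less_exp le_less_trans not_less)
      then show False using that by (simp add: set_decode_def)
    qed
    then show ?thesis by auto
  qed
  ultimately show "Delta11_fun x (\<lambda>e. card (set_decode (e 0)))" by simp
qed

section \<open>The measure of open sets\<close>

lemma cylinder_iff: "y \<in> cylinder \<sigma> \<longleftrightarrow> \<sigma> = map y [0..<length \<sigma>]"
  unfolding cylinder_def mem_Collect_eq by (subst list_eq_iff_nth_eq) auto

lemma prefix_imp_cylinder_subset: "prefix \<tau> \<sigma> \<Longrightarrow> cylinder \<sigma> \<subseteq> cylinder \<tau>"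
proof
  fix y assume "prefix \<tau> \<sigma>" "y \<in> cylinder \<sigma>"
  then obtain \<rho> where "\<sigma> = \<tau> @ \<rho>" "\<forall>i<length \<sigma>. y i = \<sigma> ! i"
    unfolding prefix_def cylinder_def by blast
  then show "y \<in> cylinder \<tau>" unfolding cylinder_def by (simp add: nth_append)
qed

lemma prefix_map_upt: "a \<le> b \<Longrightarrow> prefix (map y [0..<a]) (map y [0..<b])"
  using upt_add_eq_append[of 0 a "b - a"] by (intro map_mono_prefix) simp

lemma prob_space_cantor: "prob_space cantor_measure"
  unfolding cantor_measure_def by (intro prob_space_PiM measure_pmf.prob_space_axioms)

lemma space_cantor [simp]: "space cantor_measure = UNIV"
  unfolding cantor_measure_def by (simp add: space_PiM)

lemma pmf_bernoulli_half: "pmf (bernoulli_pmf (1 / 2)) b = 1 / 2"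
  by (cases b) auto

lemma Compl_in_sets_cantor: "A \<in> sets cantor_measure \<Longrightarrow> - A \<in> sets cantor_measure"
  using sets.compl_sets[of A cantor_measure] by (simp add: Compl_eq_Diff_UNIV)

lemma
  shows sets_cylinder [measurable]: "cylinder \<sigma> \<in> sets cantor_measure"
    and measure_cylinder: "measure cantor_measure (cylinder \<sigma>) = (1 / 2) ^ length \<sigma>"
proof -
  interpret product_prob_space "\<lambda>_::nat. measure_pmf (bernoulli_pmf (1 / 2))" UNIV
    by unfold_locales
  have eq: "cylinder \<sigma> = prod_emb UNIV (\<lambda>_. measure_pmf (bernoulli_pmf (1 / 2)))
      {..<length \<sigma>} (\<Pi>\<^sub>E i\<in>{..<length \<sigma>}. {\<sigma> ! i})"
    by (rule set_eqI) (simp add: cylinder_def prod_emb_iff PiE_iff Ball_def)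
  show "cylinder \<sigma> \<in> sets cantor_measure"
    unfolding eq cantor_measure_def by (rule sets_PiM_I) auto
  have "measure cantor_measure (cylinder \<sigma>) =
      (\<Prod>i<length \<sigma>. measure (measure_pmf (bernoulli_pmf (1 / 2))) {\<sigma> ! i})"
    unfolding eq cantor_measure_def by (rule measure_PiM_emb) auto
  also have "\<dots> = (\<Prod>i<length \<sigma>. 1 / 2)"
    by (intro prod.cong refl) (simp add: measure_pmf_single pmf_bernoulli_half)
  finally show "measure cantor_measure (cylinder \<sigma>) = (1 / 2) ^ length \<sigma>" by simp
qed

lemma measure_Union_cylinder:
  assumes "finite S" "\<And>\<sigma>. \<sigma> \<in> S \<Longrightarrow> length \<sigma> = m"
  shows "measure cantor_measure (\<Union>\<sigma>\<in>S. cylinder \<sigma>) = card S / 2 ^ m"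
proof -
  interpret prob_space cantor_measure by (rule prob_space_cantor)
  have "disjoint_family_on cylinder S"
    unfolding disjoint_family_on_def using assms(2) by (auto simp: cylinder_iff)
  then have "measure cantor_measure (\<Union>\<sigma>\<in>S. cylinder \<sigma>) = (\<Sum>\<sigma>\<in>S. measure cantor_measure (cylinder \<sigma>))"
    using assms(1) by (intro finite_measure_finite_Union) auto
  also have "\<dots> = (\<Sum>\<sigma>\<in>S. (1 / 2) ^ m)"
    using assms(2) by (intro sum.cong) (auto simp: measure_cylinder)
  finally show ?thesis by (simp add: power_one_over divide_simps)
qed

lemma open_measure_one_approx:
  assumes "measure cantor_measure (\<Union>\<sigma>\<in>W. cylinder \<sigma>) = 1"
  shows "\<exists>m S. finite S \<and> 2 ^ m * 2 ^ k \<le> card S * 2 ^ k + 2 ^ m \<and>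
    (\<forall>\<sigma>\<in>S. length \<sigma> = m \<and> (\<exists>\<tau>\<in>W. prefix \<tau> \<sigma>))"
proof -
  interpret prob_space cantor_measure by (rule prob_space_cantor)
  define S where "S m = {\<sigma>. length \<sigma> = m \<and> (\<exists>\<tau>\<in>W. prefix \<tau> \<sigma>)}" for m
  have len: "\<sigma> \<in> S m \<Longrightarrow> length \<sigma> = m" for \<sigma> m by (simp add: S_def)
  have fin: "finite (S m)" for m
    by (rule finite_subset[OF _ finite_lists_length_eq[of UNIV m]]) (auto simp: S_def)
  have meas: "measure cantor_measure (\<Union>\<sigma>\<in>S m. cylinder \<sigma>) = card (S m) / 2 ^ m" for m
    using fin len by (rule measure_Union_cylinder)
  have iff: "y \<in> (\<Union>\<sigma>\<in>S m. cylinder \<sigma>) \<longleftrightarrow> (\<exists>\<tau>\<in>W. length \<tau> \<le> m \<and> y \<in> cylinder \<tau>)" for y m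
  proof
    assume "y \<in> (\<Union>\<sigma>\<in>S m. cylinder \<sigma>)"
    then obtain \<sigma> \<tau> where "y \<in> cylinder \<sigma>" "length \<sigma> = m" "\<tau> \<in> W" "prefix \<tau> \<sigma>"
      by (auto simp: S_def)
    then show "\<exists>\<tau>\<in>W. length \<tau> \<le> m \<and> y \<in> cylinder \<tau>"
      using prefix_imp_cylinder_subset prefix_length_le by blast
  next
    assume "\<exists>\<tau>\<in>W. length \<tau> \<le> m \<and> y \<in> cylinder \<tau>"
    then obtain \<tau> where \<tau>: "\<tau> \<in> W" "length \<tau> \<le> m" "map y [0..<length \<tau>] = \<tau>"
      unfolding cylinder_iff by metis
    have "prefix \<tau> (map y [0..<m])"
      using prefix_map_upt[OF \<tau>(2), of y] unfolding \<tau>(3) .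
    then have "map y [0..<m] \<in> S m"
      using \<tau>(1) by (auto simp: S_def)
    then show "y \<in> (\<Union>\<sigma>\<in>S m. cylinder \<sigma>)"
      by (intro UN_I) (auto simp: cylinder_iff)
  qed
  have "(\<lambda>m. measure cantor_measure (\<Union>\<sigma>\<in>S m. cylinder \<sigma>)) \<longlonglongrightarrow>
      measure cantor_measure (\<Union>m. \<Union>\<sigma>\<in>S m. cylinder \<sigma>)"
  proof (rule finite_Lim_measure_incseq)
    show "incseq (\<lambda>m. \<Union>\<sigma>\<in>S m. cylinder \<sigma>)"
      unfolding incseq_def subset_iff iff using le_trans by blast
    show "range (\<lambda>m. \<Union>\<sigma>\<in>S m. cylinder \<sigma>) \<subseteq> sets cantor_measure"
      using fin by auto
  qed
  moreover have "(\<Union>m. \<Union>\<sigma>\<in>S m. cylinder \<sigma>) = (\<Union>\<sigma>\<in>W. cylinder \<sigma>)"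
    unfolding set_eq_iff UN_iff[of _ "\<lambda>m. \<Union>\<sigma>\<in>S m. cylinder \<sigma>"] iff by auto
  ultimately have "(\<lambda>m. card (S m) / 2 ^ m) \<longlonglongrightarrow> 1"
    using assms by (simp add: meas)
  moreover have "1 - (1 / 2) ^ k < (1::real)" by simp
  ultimately have "\<forall>\<^sub>F m in sequentially. 1 - (1 / 2) ^ k < card (S m) / 2 ^ m"
    by (rule order_tendstoD(1))
  then obtain m where "1 - (1 / 2) ^ k < card (S m) / 2 ^ m"
    using eventually_happens'[OF sequentially_bot] by blast
  then have "(2::real) ^ m * 2 ^ k \<le> card (S m) * 2 ^ k + 2 ^ m"
    by (simp add: field_simps power_one_over)
  then have "real (2 ^ m * 2 ^ k) \<le> real (card (S m) * 2 ^ k + 2 ^ m)" by simp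
  then have "2 ^ m * 2 ^ k \<le> card (S m) * 2 ^ k + 2 ^ m" by (simp only: of_nat_le_iff)
  then show ?thesis using fin by (intro exI[of _ m] exI[of _ "S m"]) (simp add: S_def)
qed

lemma sum_power_half_le: "(\<Sum>k\<in>{n..N}. (1 / 2) ^ k) \<le> 2 * (1 / 2 :: real) ^ n"
proof (cases "n \<le> N")
  case True
  then have "(\<Sum>k\<in>{n..N}. (1 / 2) ^ k) = 2 * (1 / 2 :: real) ^ n - (1 / 2) ^ N"
  proof (induction N rule: dec_induct)
    case (step N)
    have "(1 / 2 :: real) ^ N = 2 * (1 / 2) ^ Suc N" by simp
    then show ?case using step by (simp only: sum.nat_ivl_Suc' le_SucI)
  qed simp
  then show ?thesis by simp
qed simp

lemma measure_INT_ge: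
  fixes D :: "nat \<Rightarrow> (nat \<Rightarrow> bool) set"
  assumes "K \<subseteq> {n..N}" "\<And>k. k \<in> K \<Longrightarrow> D k \<in> sets cantor_measure"
    "\<And>k. k \<in> K \<Longrightarrow> measure cantor_measure (D k) \<ge> 1 - (1 / 2) ^ k"
    "(\<Inter>k\<in>K. D k) \<subseteq> V" "V \<in> sets cantor_measure"
  shows "measure cantor_measure V \<ge> 1 - 2 * (1 / 2) ^ n"
proof -
  interpret prob_space cantor_measure by (rule prob_space_cantor)
  have fin: "finite K" using assms(1) by (rule finite_subset) simp
  have "1 - measure cantor_measure V = measure cantor_measure (- V)"
    using prob_compl[OF assms(5)] by (simp add: Compl_eq_Diff_UNIV)
  also have "\<dots> \<le> measure cantor_measure (\<Union>k\<in>K. - D k)"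
    using assms(2,4) fin
    by (intro finite_measure_mono sets.finite_UN) (auto intro: Compl_in_sets_cantor)
  also have "\<dots> \<le> (\<Sum>k\<in>K. measure cantor_measure (- D k))"
    using assms(2) fin
    by (intro finite_measure_subadditive_finite) (auto intro: Compl_in_sets_cantor)
  also have "\<dots> \<le> (\<Sum>k\<in>K. (1 / 2) ^ k)"
  proof (rule sum_mono)
    fix k assume k: "k \<in> K"
    show "measure cantor_measure (- D k) \<le> (1 / 2) ^ k"
      using prob_compl[OF assms(2)[OF k]] assms(3)[OF k] by (simp add: Compl_eq_Diff_UNIV)
  qed
  also have "\<dots> \<le> (\<Sum>k\<in>{n..N}. (1 / 2) ^ k)"
    using assms(1) by (intro sum_mono2) auto
  also have "\<dots> \<le> 2 * (1 / 2) ^ n" by (rule sum_power_half_le)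
  finally show ?thesis by simp
qed

section \<open>Lowness for Kurtz tests\<close>

text \<open>The number \<open>prod_encode (m, set_encode (string_code ` S))\<close> codes the clopen set given by a
  set \<open>S\<close> of strings of the same length \<open>m\<close>, so that its measure is \<open>card S / 2\<^sup>m\<close>.\<close>

definition clopen_strings :: "nat \<Rightarrow> bool list set" where
  "clopen_strings z = string_code -` set_decode (snd (prod_decode z))"

definition large_clopen :: "nat \<Rightarrow> nat \<Rightarrow> bool" where
  "large_clopen k z \<longleftrightarrow>
    (\<forall>s. s \<in> set_decode (snd (prod_decode z)) \<longrightarrow>
      s \<in> range string_code \<and> length (list_decode s) = fst (prod_decode z)) \<and>
    2 ^ fst (prod_decode z) * 2 ^ k \<le>
      card (set_decode (snd (prod_decode z))) * 2 ^ k + 2 ^ fst (prod_decode z)"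

lemma Delta11_pred_large_clopen:
  assumes "Delta11_fun x F" "Delta11_fun x G"
  shows "Delta11_pred x (\<lambda>e. large_clopen (F e) (G e))"
  unfolding large_clopen_def
  by (rule Delta11_pred_comp2[OF _ assms]) (intro Delta11_intros Delta11_pred_set_decode
    Delta11_pred_string Delta11_fun_length Delta11_fun_card_set_decode Delta11_fun_power2
    Delta11_fun_fst_prod_decode Delta11_fun_snd_prod_decode)

lemma finite_clopen_strings: "finite (clopen_strings z)"
  unfolding clopen_strings_def using inj_string_code by (intro finite_vimageI) auto

lemma large_clopen_measure:
  assumes "large_clopen k z"
  shows "measure cantor_measure (\<Union>\<sigma>\<in>clopen_strings z. cylinder \<sigma>) \<ge> 1 - (1 / 2) ^ k"
proof -
  let ?m = "fst (prod_decode z)" and ?c = "snd (prod_decode z)"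
  have str: "s \<in> range string_code" "length (list_decode s) = ?m" if "s \<in> set_decode ?c" for s
    using assms that unfolding large_clopen_def by blast+
  have "string_code ` clopen_strings z = set_decode ?c"
    unfolding clopen_strings_def using str(1) by blast
  then have card: "card (set_decode ?c) = card (clopen_strings z)"
    using card_image[OF inj_on_subset[OF inj_string_code subset_UNIV]] by metis
  have "length \<sigma> = ?m" if "\<sigma> \<in> clopen_strings z" for \<sigma>
    using str(2)[of "string_code \<sigma>"] that by (simp add: clopen_strings_def)
  then have meas: "measure cantor_measure (\<Union>\<sigma>\<in>clopen_strings z. cylinder \<sigma>) =
      card (clopen_strings z) / 2 ^ ?m"
    by (intro measure_Union_cylinder finite_clopen_strings)
  have "2 ^ ?m * 2 ^ k \<le> card (clopen_strings z) * 2 ^ k + 2 ^ ?m"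
    using assms unfolding large_clopen_def card by blast
  then have "real (2 ^ ?m * 2 ^ k) \<le> real (card (clopen_strings z) * 2 ^ k + 2 ^ ?m)"
    by (simp only: of_nat_le_iff)
  then show ?thesis unfolding meas by (simp add: field_simps power_one_over)
qed

lemma large_clopen_exists:
  assumes "measure cantor_measure (\<Union>\<sigma>\<in>W. cylinder \<sigma>) = 1"
  shows "\<exists>z. large_clopen k z \<and> (\<forall>\<sigma>\<in>clopen_strings z. \<exists>\<tau>\<in>W. prefix \<tau> \<sigma>)"
proof -
  obtain m S where S: "finite S" "2 ^ m * 2 ^ k \<le> card S * 2 ^ k + 2 ^ m"
    "\<forall>\<sigma>\<in>S. length \<sigma> = m \<and> (\<exists>\<tau>\<in>W. prefix \<tau> \<sigma>)"
    using open_measure_one_approx[OF assms, of k] by blast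
  define z where "z = prod_encode (m, set_encode (string_code ` S))"
  have fst: "fst (prod_decode z) = m" and snd: "set_decode (snd (prod_decode z)) = string_code ` S"
    using S(1) by (simp_all add: z_def)
  have "card (string_code ` S) = card S"
    by (intro card_image inj_on_subset[OF inj_string_code]) simp
  then have "large_clopen k z"
    unfolding large_clopen_def fst snd using S(2,3) by auto
  moreover have "clopen_strings z = S"
    unfolding clopen_strings_def snd by (rule inj_vimage_image_eq[OF inj_string_code])
  ultimately show ?thesis using S(3) by blast
qed

theorem theorem5p1:
  fixes x :: "nat \<Rightarrow> bool"
  assumes "Delta11_dominated x"
    and "Delta11_semi_traceable x"
  shows "low_for_Delta11_Kurtz_tests x"
  unfolding low_for_Delta11_Kurtz_tests_def
proof (intro allI impI, elim conjE)
  fix U assume U: "Delta11_open_in x U" "measure cantor_measure U = 1"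
  interpret prob_space cantor_measure by (rule prob_space_cantor)
  obtain W where W: "Delta11_in x (string_code ` W)" and UW: "U = (\<Union>\<sigma>\<in>W. cylinder \<sigma>)"
    using U(1) unfolding Delta11_open_in_def by blast
  define inside where "inside z \<longleftrightarrow> (\<forall>s. s \<in> set_decode (snd (prod_decode z)) \<longrightarrow>
    (\<exists>t. t \<in> string_code ` W \<and> prefix (list_decode t) (list_decode s)))" for z
  have Delta11_inside: "Delta11_pred x (\<lambda>e. inside (e i))" for i
    unfolding inside_def
    using Delta11_pred_comp[OF W[unfolded Delta11_in_iff] Delta11_fun_var]
    by (intro Delta11_intros Delta11_pred_set_decode Delta11_pred_prefix
      Delta11_fun_snd_prod_decode) simp
  have inside: "\<exists>\<tau>\<in>W. prefix \<tau> \<sigma>" if "inside z" "\<sigma> \<in> clopen_strings z" for z \<sigma>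
    using that unfolding inside_def clopen_strings_def by (fastforce simp: prefix_map_of_bool)

  define f where "f k = (LEAST z. large_clopen k z \<and> inside z)" for k
  have ex: "\<exists>z. large_clopen k z \<and> inside z" for k
  proof -
    obtain z where z: "large_clopen k z" "\<forall>\<sigma>\<in>clopen_strings z. \<exists>\<tau>\<in>W. prefix \<tau> \<sigma>"
      using large_clopen_exists U(2) unfolding UW by blast
    have "inside z" unfolding inside_def
    proof (intro allI impI)
      fix s assume s: "s \<in> set_decode (snd (prod_decode z))"
      then obtain \<sigma> where \<sigma>: "s = string_code \<sigma>"
        using z(1) unfolding large_clopen_def by blast
      then obtain \<tau> where "\<tau> \<in> W" "prefix \<tau> \<sigma>"
        using s z(2) unfolding clopen_strings_def by blast
      then show "\<exists>t. t \<in> string_code ` W \<and> prefix (list_decode t) (list_decode s)"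
        unfolding \<sigma> by (intro exI[of _ "string_code \<tau>"]) (simp add: prefix_map_of_bool)
    qed
    then show ?thesis using z(1) by blast
  qed
  have f: "large_clopen k (f k)" "inside (f k)" for k
    using LeastI_ex[OF ex[of k]] unfolding f_def by blast+
  have "Delta11_fun x (\<lambda>e. f (e 0))"
    unfolding f_def
    by (intro Delta11_fun_Least Delta11_intros Delta11_pred_large_clopen Delta11_inside ex)
  then have hyp_f: "f \<le>\<^sub>h x" unfolding hyp_in_iff .
  then obtain g where g: "hyperarithmetic g" "infinite {n. f n = g n}"
    using assms(2) unfolding Delta11_semi_traceable_def by blast

  define h where "h n = (LEAST k. n \<le> k \<and> f k = g k)" for n
  have ex_h: "\<exists>k. n \<le> k \<and> f k = g k" for n
    using g(2) unfolding infinite_nat_iff_unbounded_le by auto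
  have h: "n \<le> h n" "f (h n) = g (h n)" for n
    using LeastI_ex[OF ex_h[of n]] unfolding h_def by blast+
  note f_comp = Delta11_fun_comp[OF hyp_f[unfolded hyp_in_iff]]
    and g_comp = Delta11_fun_comp[OF hyperarithmetic_imp_hyp_in[OF g(1), unfolded hyp_in_iff]]
  have "Delta11_fun x (\<lambda>e. h (e 0))"
    unfolding h_def by (intro Delta11_fun_Least Delta11_intros f_comp g_comp ex_h)
  then obtain b where b: "hyperarithmetic b" "\<And>n. h n \<le> b n"
    using assms(1) unfolding Delta11_dominated_def hyp_in_iff[symmetric] by blast

  define W' where "W' = {\<sigma>. \<exists>n. \<forall>k. n \<le> k \<and> k \<le> b n \<and> large_clopen k (g k) \<longrightarrow>
    (\<exists>\<tau>\<in>clopen_strings (g k). prefix \<tau> \<sigma>)}"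
  define V where "V = (\<Union>\<sigma>\<in>W'. cylinder \<sigma>)"
  have "string_code ` W' = {z. z \<in> range string_code \<and>
      (\<exists>n. \<forall>k. n \<le> k \<and> k \<le> b n \<and> large_clopen k (g k) \<longrightarrow>
        (\<exists>t. t \<in> set_decode (snd (prod_decode (g k))) \<and> t \<in> range string_code \<and>
          prefix (list_decode t) (list_decode z)))}" (is "_ = ?A")
  proof -
    have mem: "(\<exists>\<tau>\<in>clopen_strings z. prefix \<tau> \<sigma>) \<longleftrightarrow>
        (\<exists>t. t \<in> set_decode (snd (prod_decode z)) \<and> t \<in> range string_code \<and>
          prefix (list_decode t) (list_decode (string_code \<sigma>)))" for z \<sigma>
      unfolding clopen_strings_def by (auto simp: prefix_map_of_bool)
    show ?thesis unfolding W'_def mem by blast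
  qed
  moreover have "Delta11_in empty_real ?A"
    unfolding Delta11_in_iff mem_Collect_eq
    by (intro Delta11_intros Delta11_pred_string Delta11_pred_set_decode Delta11_pred_prefix
      Delta11_pred_large_clopen Delta11_fun_snd_prod_decode
      Delta11_fun_comp[OF b(1)[unfolded hyperarithmetic_def hyp_in_iff]]
      Delta11_fun_comp[OF g(1)[unfolded hyperarithmetic_def hyp_in_iff]])
  ultimately have "Delta11_in empty_real (string_code ` W')" by (simp only:)
  then have "Delta11_open V"
    unfolding Delta11_open_def Delta11_open_in_def V_def by blast

  moreover have "V \<subseteq> U"
  proof
    fix y assume "y \<in> V"
    then obtain \<sigma> n where y: "y \<in> cylinder \<sigma>" and
      n: "\<And>k. n \<le> k \<Longrightarrow> k \<le> b n \<Longrightarrow> large_clopen k (g k) \<Longrightarrow>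
        \<exists>\<tau>\<in>clopen_strings (g k). prefix \<tau> \<sigma>"
      unfolding V_def W'_def by blast
    obtain \<tau> where \<tau>: "\<tau> \<in> clopen_strings (f (h n))" "prefix \<tau> \<sigma>"
      using n[of "h n"] h[of n] b(2)[of n] f(1)[of "h n"] by auto
    then obtain \<rho> where \<rho>: "\<rho> \<in> W" "prefix \<rho> \<tau>"
      using inside[OF f(2)] by blast
    have "y \<in> cylinder \<rho>"
      using y prefix_imp_cylinder_subset[OF prefix_order.trans[OF \<rho>(2) \<tau>(2)]] by blast
    then show "y \<in> U" unfolding UW using \<rho>(1) by blast
  qed

  moreover have "measure cantor_measure V = 1"
  proof -
    have V_sets: "V \<in> sets cantor_measure"
      unfolding V_def by (intro sets.countable_UN' sets_cylinder) auto
    have ge: "1 - 2 * (1 / 2) ^ n \<le> measure cantor_measure V" for n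
    proof (rule measure_INT_ge[OF _ _ _ _ V_sets])
      let ?K = "{k. n \<le> k \<and> k \<le> b n \<and> large_clopen k (g k)}"
        and ?D = "\<lambda>k. \<Union>\<sigma>\<in>clopen_strings (g k). cylinder \<sigma>"
      show "?K \<subseteq> {n..b n}" by auto
      show "?D k \<in> sets cantor_measure" for k
        by (intro sets.finite_UN finite_clopen_strings sets_cylinder)
      show "1 - (1 / 2) ^ k \<le> measure cantor_measure (?D k)" if "k \<in> ?K" for k
        using that large_clopen_measure by blast
      show "(\<Inter>k\<in>?K. ?D k) \<subseteq> V"
      proof
        fix y assume "y \<in> (\<Inter>k\<in>?K. ?D k)"
        then have "\<forall>k\<in>?K. \<exists>\<tau>. \<tau> \<in> clopen_strings (g k) \<and> y \<in> cylinder \<tau>" by blast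
        then obtain T where T: "\<And>k. k \<in> ?K \<Longrightarrow> T k \<in> clopen_strings (g k) \<and> y \<in> cylinder (T k)"
          by metis
        define \<sigma> where "\<sigma> = map y [0..<(\<Sum>k\<in>{n..b n}. length (T k))]"
        have "prefix (T k) \<sigma>" if "k \<in> ?K" for k
        proof -
          have "length (T k) \<le> (\<Sum>k\<in>{n..b n}. length (T k))"
            using that by (intro member_le_sum) auto
          then have "prefix (map y [0..<length (T k)]) \<sigma>"
            unfolding \<sigma>_def by (rule prefix_map_upt)
          then show ?thesis using T[OF that] unfolding cylinder_iff by metis
        qed
        then have "\<sigma> \<in> W'" unfolding W'_def using T by blast
        moreover have "y \<in> cylinder \<sigma>" by (simp add: cylinder_iff \<sigma>_def)
        ultimately show "y \<in> V" unfolding V_def by blast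
      qed
    qed
    have "(\<lambda>n. 1 - 2 * (1 / 2) ^ n) \<longlonglongrightarrow> 1 - 2 * (0::real)"
      by (intro tendsto_intros LIMSEQ_power_zero) simp
    then have "1 - 2 * 0 \<le> measure cantor_measure V"
      by (rule LIMSEQ_le_const2) (use ge in blast)
    then show ?thesis using prob_le_1[of V] by simp
  qed
  ultimately show "\<exists>V. Delta11_open V \<and> V \<subseteq> U \<and> measure cantor_measure V = 1" by blast
qed

end
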